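(* Let $m,n\ge 1$, let $B=(b_{k,j})_{k=1,\dots,m;\ j=0,\dots,n-1}\in\mathbb{R}^{m\times n}$ be a real matrix with $m$ rows and full rank (i.e. rank $m$), and let $d\in\mathbb{R}^m$. Let $\bar c_1,\bar c_2\in\mathbb{R}^{2n-1}$, with entries indexed by $j=-n+1,\dots,n-1$, satisfy $(\bar c_k)_{j}=(\bar c_k)_{-j}$ for $k=1,2$ and all $j$, and put $$\bar a_0^l(t)=\sum_{j=-n+1}^{n-1}(\bar c_1)_j\cos(jt),\qquad \bar a_0^u(t)=\sum_{j=-n+1}^{n-1}(\bar c_2)_j\cos(jt).$$ Suppose that $\bar a_0^u(t)>0$ and $\bar a_0^l(t)<0$ for all $t\in[0,\pi]$. Then the optimal value of the symmetric Toeplitz matrix completion problem $$\min_{x\in\mathbb{R}^n}\ r(T(x))\quad\text{subject to}\quad Bx=d$$ is at most $2m$; that is, there exists $x\in\mathbb{R}^n$ with $Bx=d$ and $r(T(x))\le 2m$.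
   Context: For $x=(x_0,x_1,\dots,x_{n-1})^T\in\mathbb{R}^n$, $T(x)$ denotes the $n\times n$ real symmetric Toeplitz matrix with first row $x$, i.e. the matrix whose $(k,l)$ entry is $x_{|k-l|}$ for $k,l\in\{1,\dots,n\}$. $r(\cdot)$ denotes the rank of a matrix. *)

theory Defs
  imports
    Complex_Main
    "HOL-Library.Extended_Nat"
    "Jordan_Normal_Form.Matrix"
    "Jordan_Normal_Form.DL_Rank"
begin

definition sym_toeplitz :: "real vec \<Rightarrow> real mat" where
  "sym_toeplitz x =
     mat (dim_vec x) (dim_vec x) (\<lambda>(k, l). x $ nat \<bar>int k - int l\<bar>)"

(* The library constant vec_space.rank is the dimension of the column span inside the space of
   vectors of the given dimension, so its first argument has to be the number of rows. *)
abbreviation mat_rank :: "real mat \<Rightarrow> nat" where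
  "mat_rank A \<equiv> vec_space.rank (dim_row A) A"

(* A vector with entries indexed by j = -n+1, ..., n-1 is a function on the integers;
   only its values at these indices matter. *)
definition cos_sum :: "nat \<Rightarrow> (int \<Rightarrow> real) \<Rightarrow> real \<Rightarrow> real" where
  "cos_sum n c t = (\<Sum>j = - int n + 1..int n - 1. c j * cos (of_int j * t))"

definition feasible :: "real mat \<Rightarrow> real vec \<Rightarrow> real vec set" where
  "feasible B d = {x \<in> carrier_vec (dim_col B). B *\<^sub>v x = d}"

(* With values in enat an infeasible problem has optimal value \<infinity>;
   over a nonempty feasible set the infimum is a minimum. *)
definition optimal_value :: "real mat \<Rightarrow> real vec \<Rightarrow> enat" where
  "optimal_value B d = (INF x \<in> feasible B d. enat (mat_rank (sym_toeplitz x)))"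

end

theory Submission
  imports Defs
begin

text \<open>
  A weighted sum of \<open>m\<close> cosine sequences \<open>j \<mapsto> cos (j t)\<close> has a Toeplitz matrix of rank at most
  \<open>2 m\<close>, because \<open>cos ((k - l) t) = cos (k t) cos (l t) + sin (k t) sin (l t)\<close>. Sampling at the
  \<open>n\<close> Chebyshev nodes \<open>t = (2 k + 1) pi / (2 n)\<close> gives \<open>n\<close> cosine vectors that span the whole space
  (invertibility of the discrete cosine transform), so their images under \<open>B\<close> span the column
  space of \<open>B\<close>; since \<open>B\<close> has rank \<open>m\<close>, some \<open>m\<close> of these images form a basis, in which \<open>d\<close> can be
  expanded.
\<close>

section \<open>Trigonometric identities\<close>

lemma cos_abs_diff_mult:
  "cos (real (nat \<bar>int k - int l\<bar>) * t)
    = cos (real k * t) * cos (real l * t) + sin (real k * t) * sin (real l * t)"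
proof -
  have "\<bar>real_of_int (int k - int l) * t\<bar> = \<bar>real (nat \<bar>int k - int l\<bar>) * t\<bar>"
    by (simp add: abs_mult)
  then have "cos (real (nat \<bar>int k - int l\<bar>) * t) = cos (real k * t - real l * t)"
    by (metis cos_abs_real left_diff_distrib of_int_diff of_int_of_nat_eq)
  then show ?thesis
    by (simp add: cos_diff)
qed

text \<open>Multiplied by \<open>2 * sin h\<close>, each summand becomes a difference of sines at
  consecutive even multiples of \<open>h\<close>, so the sum telescopes.\<close>

lemma sum_cos_odd_multiples:
  fixes h :: real
  shows "2 * sin h * (\<Sum>k<n. cos (real (2 * k + 1) * h)) = sin (real (2 * n) * h)"
proof (induction n)
  case (Suc n)
  have "sin (real (2 * Suc n) * h) = sin (real (2 * n + 1) * h + h)"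
    and "sin (real (2 * n) * h) = sin (real (2 * n + 1) * h - h)"
    by (simp_all add: algebra_simps)
  then have "sin (real (2 * Suc n) * h) - sin (real (2 * n) * h)
      = 2 * sin h * cos (real (2 * n + 1) * h)"
    unfolding sin_add sin_diff by simp
  then show ?case
    using Suc.IH by (simp add: distrib_left)
qed simp

section \<open>Discrete cosine transform at the Chebyshev nodes\<close>

definition cheb_node :: "nat \<Rightarrow> nat \<Rightarrow> real" where
  "cheb_node n k = real (2 * k + 1) * (pi / real (2 * n))"

text \<open>The unnormalised DCT-II matrix; its columns are the cosine sequences at the
  nodes.\<close>

definition dct_mat :: "nat \<Rightarrow> real mat" where
  "dct_mat n = mat n n (\<lambda>(j, k). cos (real j * cheb_node n k))"

lemma sum_cos_cheb_node_eq_0: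
  assumes "0 < l" and "l < 2 * n"
  shows "(\<Sum>k<n. cos (real l * cheb_node n k)) = 0"
proof -
  define h where "h = real l * (pi / real (2 * n))"
  \<comment> \<open>The range of \<open>l\<close> is exactly what keeps \<open>sin h\<close> away
    from 0, so that it can be cancelled below.\<close>
  have "0 < h" "h < pi"
    using assms by (auto simp: h_def field_simps simp flip: of_nat_mult)
  then have "sin h \<noteq> 0"
    using sin_gt_zero by force
  moreover have "real (2 * n) * h = real l * pi"
    using assms by (simp add: h_def)
  then have "sin (real (2 * n) * h) = 0"
    by simp
  ultimately have "(\<Sum>k<n. cos (real (2 * k + 1) * h)) = 0"
    using sum_cos_odd_multiples[of h n] by simp
  then show ?thesis
    by (simp add: h_def cheb_node_def mult.left_commute)
qed

text \<open>The product-to-sum formula leaves the frequencies \<open>i - j\<close> and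
  \<open>i + j\<close>, both below \<open>2 * n\<close> in absolute value, so only frequency 0
  survives. Both vanish when \<open>i = j = 0\<close>, which explains the doubled value
  there.\<close>

lemma sum_cos_mult_cos_cheb_node:
  assumes "i < n" and "j < n"
  shows "(\<Sum>k<n. cos (real i * cheb_node n k) * cos (real j * cheb_node n k))
    = (if i = j then if i = 0 then real n else real n / 2 else 0)"
proof -
  have *: "cos (real i * t) * cos (real j * t)
      = (cos (real (nat \<bar>int i - int j\<bar>) * t) + cos (real (i + j) * t)) / 2" for t
    unfolding cos_abs_diff_mult by (simp add: distrib_right cos_add)
  have "(\<Sum>k<n. cos (real (nat \<bar>int i - int j\<bar>) * cheb_node n k)) = (if i = j then real n else 0)"
  proof (cases "i = j")
    case False
    then show ?thesis
      using assms sum_cos_cheb_node_eq_0[of "nat \<bar>int i - int j\<bar>" n] by auto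
  qed simp
  moreover have "(\<Sum>k<n. cos (real (i + j) * cheb_node n k)) = (if i = 0 \<and> j = 0 then real n else 0)"
    using assms by (auto intro!: sum_cos_cheb_node_eq_0 simp del: of_nat_add)
  ultimately show ?thesis
    unfolding * by (simp add: sum.distrib flip: sum_divide_distrib del: of_nat_add)
qed

lemma dct_mat_right_inverse:
  obtains Y where "Y \<in> carrier_mat n n" and "dct_mat n * Y = 1\<^sub>m n"
proof
  \<comment> \<open>The rows of \<open>dct_mat n\<close> are orthogonal, so its inverse is the
    transpose with columns divided by the squared row norms \<open>n\<close> (row 0) and
    \<open>n / 2\<close> (the others).\<close>
  define Y where "Y = mat n n (\<lambda>(k, j).
    (if j = 0 then 1 / real n else 2 / real n) * cos (real j * cheb_node n k))"
  show "Y \<in> carrier_mat n n"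
    by (simp add: Y_def)
  show "dct_mat n * Y = 1\<^sub>m n"
  proof (rule eq_matI)
    fix i j assume "i < dim_row (1\<^sub>m n :: real mat)" "j < dim_col (1\<^sub>m n :: real mat)"
    then have ij: "i < n" "j < n" by simp_all
    have "(dct_mat n * Y) $$ (i, j) = (\<Sum>k<n. cos (real i * cheb_node n k) *
        ((if j = 0 then 1 / real n else 2 / real n) * cos (real j * cheb_node n k)))"
      using ij by (simp add: dct_mat_def Y_def scalar_prod_def lessThan_atLeast0)
    also have "\<dots> = (if j = 0 then 1 / real n else 2 / real n) *
        (\<Sum>k<n. cos (real i * cheb_node n k) * cos (real j * cheb_node n k))"
      by (simp only: sum_distrib_left mult.left_commute)
    also have "\<dots> = 1\<^sub>m n $$ (i, j)"
      using ij by (simp add: sum_cos_mult_cos_cheb_node)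
    finally show "(dct_mat n * Y) $$ (i, j) = 1\<^sub>m n $$ (i, j)" .
  qed (simp_all add: dct_mat_def Y_def)
qed

section \<open>Rank of Toeplitz matrices of cosine sums\<close>

lemma (in vec_space) rank_sum_products_le:
  fixes f g :: "'b \<Rightarrow> nat \<Rightarrow> 'a"
  assumes "finite I"
  shows "rank (mat n nc (\<lambda>(r, c). \<Sum>i\<in>I. f i r * g i c)) \<le> card I"
  using assms
proof (induction I rule: finite_induct)
  case empty
  have "mat n nc (\<lambda>(r, c). \<Sum>i\<in>{}. f i r * g i c) = 0\<^sub>m n nc"
    by (intro eq_matI) auto
  then show ?case
    by (simp only: rank_0I card.empty)
next
  case (insert i I)
  let ?A = "mat n nc (\<lambda>(r, c). f i r * g i c)"
  let ?S = "mat n nc (\<lambda>(r, c). \<Sum>i\<in>I. f i r * g i c)"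
  have "mat n nc (\<lambda>(r, c). \<Sum>i\<in>insert i I. f i r * g i c) = ?A + ?S"
    using insert.hyps by (intro eq_matI) auto
  moreover have "rank ?A \<le> 1"
    by (rule rank_le_1_product_entries[where nc = nc and f = "f i" and g = "g i"]) auto
  ultimately show ?case
    using rank_subadditive[of ?A nc ?S] insert by simp
qed

lemma mat_rank_sym_toeplitz_cos_le:
  assumes "finite I"
  shows "mat_rank (sym_toeplitz (vec n (\<lambda>j. \<Sum>i\<in>I. a i * cos (real j * t i)))) \<le> 2 * card I"
    (is "mat_rank (sym_toeplitz ?x) \<le> _")
proof -
  \<comment> \<open>The cosine and sine halves of the addition formula: each is a sum of
    \<open>card I\<close> outer products.\<close>
  define C where "C = mat n n (\<lambda>(k, l). \<Sum>i\<in>I. (a i * cos (real k * t i)) * cos (real l * t i))"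
  define S where "S = mat n n (\<lambda>(k, l). \<Sum>i\<in>I. (a i * sin (real k * t i)) * sin (real l * t i))"
  have "sym_toeplitz ?x = C + S"
  proof (rule eq_matI)
    fix k l assume "k < dim_row (C + S)" "l < dim_col (C + S)"
    then have kl: "k < n" "l < n" by (simp_all add: S_def)
    then have "nat \<bar>int k - int l\<bar> < n" by linarith
    then have "sym_toeplitz ?x $$ (k, l)
        = (\<Sum>i\<in>I. a i * cos (real (nat \<bar>int k - int l\<bar>) * t i))"
      using kl by (simp add: sym_toeplitz_def)
    also have "\<dots> = (C + S) $$ (k, l)"
      unfolding cos_abs_diff_mult
      using kl by (simp add: C_def S_def distrib_left sum.distrib mult.assoc)
    finally show "sym_toeplitz ?x $$ (k, l) = (C + S) $$ (k, l)" .
  qed (simp_all add: sym_toeplitz_def S_def)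
  moreover have "vec_space.rank n (C + S) \<le> vec_space.rank n C + vec_space.rank n S"
    by (rule vec_space.rank_subadditive[of _ _ n]) (simp_all add: C_def S_def)
  moreover have "vec_space.rank n C \<le> card I" "vec_space.rank n S \<le> card I"
    unfolding C_def S_def by (intro vec_space.rank_sum_products_le assms)+
  moreover have "dim_row (C + S) = n"
    by (simp add: S_def)
  ultimately show ?thesis
    by simp
qed

section \<open>Column spans and bases of columns\<close>

lemma (in vec_space) full_row_rank_span_cols:
  assumes "A \<in> carrier_mat n nc" and "rank A = n"
  shows "span (set (cols A)) = carrier_vec n"
proof -
  have cols: "set (cols A) \<subseteq> carrier_vec n"
    using assms(1) cols_dim by blast
  obtain S where S: "finite S" "maximal S (\<lambda>T. T \<subseteq> set (cols A) \<and> lin_indpt T)"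
    using maximal_exists[of "\<lambda>T. T \<subseteq> set (cols A) \<and> lin_indpt T" "card (set (cols A))" "{}"]
    by (meson List.finite_set card_mono empty_iff empty_subsetI finite_lin_indpt2 rev_finite_subset)
  then have sub: "S \<subseteq> set (cols A)" and li: "lin_indpt S"
    by (auto simp: maximal_def)
  \<comment> \<open>A maximal independent set of columns has as many elements as the rank, here the
    full dimension, so it is a basis.\<close>
  have "card S = n"
    using rank_card_indpt[OF assms(1) S(2)] assms(2) by simp
  then have "basis S"
    using S(1) sub li cols by (intro dim_li_is_basis) (auto simp: dim_is_n)
  then have "carrier_vec n \<subseteq> span (set (cols A))"
    using span_is_monotone[OF sub] by (simp add: basis_def)
  then show ?thesis
    using span_closed[OF cols] by blast
qed

text \<open>Since \<open>B = (B * C) * Y\<close>, every column of \<open>B\<close> is a combination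
  of columns of \<open>B * C\<close>. The latter therefore span the space, and a minimal spanning
  subset of them is a basis.\<close>

lemma (in vec_space) full_row_rank_basis_of_mult_cols:
  assumes B: "B \<in> carrier_mat n nc" and "rank B = n"
    and C: "C \<in> carrier_mat nc k" and Y: "Y \<in> carrier_mat k nc" and CY: "C * Y = 1\<^sub>m nc"
  obtains U where "U \<subseteq> set (cols (B * C))" and "basis U"
proof -
  have BC: "B * C \<in> carrier_mat n k"
    using B C by simp
  then have S: "set (cols (B * C)) \<subseteq> carrier_vec n"
    using cols_dim by blast
  have "B * C * Y = B"
    using B C Y CY by (simp add: assoc_mult_mat[of B n nc C k Y nc])
  have "set (cols B) \<subseteq> span (set (cols (B * C)))"
  proof
    fix v assume "v \<in> set (cols B)"
    then obtain j where j: "j < nc" "v = col B j"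
      using B by (auto simp: cols_def)
    then have v: "v = (B * C) *\<^sub>v col Y j"
      using \<open>B * C * Y = B\<close> col_mult2[OF BC Y, of j] by simp
    have len: "length (cols (B * C)) = k"
      using C by simp
    have cols: "cols (B * C) ! i \<in> carrier_vec n" if "i < length (cols (B * C))" for i
      using S nth_mem[OF that] by blast
    have "v = mat_of_cols n (cols (B * C)) *\<^sub>v col Y j"
      using v mat_of_cols_cols[of "B * C"] BC by (metis carrier_matD(1))
    moreover have "col Y j \<in> carrier_vec (length (cols (B * C)))"
      using Y len by (metis carrier_matD(1) col_dim)
    note mat_of_cols_mult_as_finsum[OF this cols]
    ultimately show "v \<in> span (set (cols (B * C)))"
      by (rule in_spanI[OF trans finite_set order_refl])
  qed
  then have "span (set (cols B)) \<subseteq> span (set (cols (B * C)))"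
    by (rule span_subsetI[OF S])
  then have "carrier_vec n \<subseteq> span (set (cols (B * C)))"
    unfolding full_row_rank_span_cols[OF assms(1,2)] .
  then have gen: "gen_set (set (cols (B * C)))"
    using span_closed[OF S] by (simp add: subset_antisym subsetI)
  obtain U where U: "U \<subseteq> set (cols (B * C))" "minimal U (\<lambda>S. S \<subseteq> carrier_vec n \<and> gen_set S)"
    using minimal_exists[of "set (cols (B * C))" "\<lambda>S. S \<subseteq> carrier_vec n \<and> gen_set S"] S gen
    by auto
  then show thesis
    using min_gen_is_basis[of U] that by auto
qed

section \<open>Solving the linear system by a cosine sum\<close>

lemma full_row_rank_cos_solution:
  assumes B: "B \<in> carrier_mat m n" and rank: "vec_space.rank m B = m" and d: "d \<in> carrier_vec m"
  obtains U :: "real vec set" and a t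
    where "finite U" and "card U = m"
      and "B *\<^sub>v vec n (\<lambda>j. \<Sum>w\<in>U. a w * cos (real j * t w)) = d"
proof -
  interpret vec_space "TYPE(real)" m .
  obtain Y where Y: "Y \<in> carrier_mat n n" "dct_mat n * Y = 1\<^sub>m n"
    by (rule dct_mat_right_inverse)
  have C: "dct_mat n \<in> carrier_mat n n"
    by (simp add: dct_mat_def)
  obtain U where U: "U \<subseteq> set (cols (B * dct_mat n))" and bas: "basis U"
    using full_row_rank_basis_of_mult_cols[OF B rank C Y] by blast
  have fin: "finite U"
    using U finite_subset by blast
  have card: "card U = m"
    using dim_basis[OF fin bas] by (simp add: dim_is_n)
  have Ucar: "U \<subseteq> carrier_vec m" and span: "span U = carrier_vec m"
    using bas by (auto simp: basis_def)
  obtain a where a: "d = lincomb a U"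
    using d span finite_in_span[OF fin Ucar] by auto
  have "\<forall>w\<in>U. \<exists>k<n. w = col (B * dct_mat n) k"
    using U C by (fastforce simp: cols_def)
  \<comment> \<open>The terms are indexed by the basis vectors themselves; if several columns equal
    \<open>w\<close>, any one of them supplies its frequency.\<close>
  then obtain \<kappa> where \<kappa>: "\<And>w. w \<in> U \<Longrightarrow> \<kappa> w < n \<and> w = col (B * dct_mat n) (\<kappa> w)"
    by metis
  define t where "t w = cheb_node n (\<kappa> w)" for w
  have w: "w $ i = (\<Sum>j<n. B $$ (i, j) * cos (real j * t w))" if "w \<in> U" "i < m" for w i
  proof -
    have "w $ i = col (B * dct_mat n) (\<kappa> w) $ i"
      using \<kappa>[OF that(1)] by metis
    also have "\<dots> = (\<Sum>j<n. B $$ (i, j) * cos (real j * t w))"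
      using conjunct1[OF \<kappa>[OF that(1)]] that(2) B
      by (simp add: dct_mat_def t_def scalar_prod_def lessThan_atLeast0)
    finally show ?thesis .
  qed
  \<comment> \<open>\<open>B\<close> maps the cosine sequence of frequency \<open>t w\<close> to
    \<open>w\<close>, so weighting these sequences by the coordinates of \<open>d\<close> in the
    basis \<open>U\<close> gives a preimage of \<open>d\<close>.\<close>
  let ?x = "vec n (\<lambda>j. \<Sum>w\<in>U. a w * cos (real j * t w))"
  have "B *\<^sub>v ?x = d"
  proof (rule eq_vecI)
    fix i assume "i < dim_vec d"
    then have i: "i < m" using d by simp
    have "(B *\<^sub>v ?x) $ i = (\<Sum>j<n. \<Sum>w\<in>U. B $$ (i, j) * (a w * cos (real j * t w)))"
      using i B by (simp add: scalar_prod_def lessThan_atLeast0 sum_distrib_left)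
    also have "\<dots> = (\<Sum>w\<in>U. a w * (\<Sum>j<n. B $$ (i, j) * cos (real j * t w)))"
      by (subst sum.swap) (simp add: sum_distrib_left mult.left_commute)
    also have "\<dots> = (\<Sum>w\<in>U. a w * w $ i)"
      using w i by simp
    also have "\<dots> = d $ i"
      using a lincomb_index[OF i Ucar] by simp
    finally show "(B *\<^sub>v ?x) $ i = d $ i" .
  qed (use B d in simp)
  with fin card show thesis
    by (rule that)
qed

theorem theorem1:
  fixes m n :: nat
    and B :: "real mat"
    and d :: "real vec"
    and c1 c2 :: "int \<Rightarrow> real"
  assumes "m \<ge> 1" and "n \<ge> 1"
    and "B \<in> carrier_mat m n"
    and "mat_rank B = m"
    and "d \<in> carrier_vec m"
    and "\<forall>j \<in> {- int n + 1..int n - 1}. c1 j = c1 (- j)"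
    and "\<forall>j \<in> {- int n + 1..int n - 1}. c2 j = c2 (- j)"
    and "\<forall>t \<in> {0..pi}. cos_sum n c2 t > 0"
    and "\<forall>t \<in> {0..pi}. cos_sum n c1 t < 0"
  shows "optimal_value B d \<le> enat (2 * m) \<and>
    (\<exists>x \<in> carrier_vec n. B *\<^sub>v x = d \<and> mat_rank (sym_toeplitz x) \<le> 2 * m)"
proof -
  have "vec_space.rank m B = m"
    using assms(3,4) by simp
  then obtain U :: "real vec set" and a t where "finite U" "card U = m"
    and sol: "B *\<^sub>v vec n (\<lambda>j. \<Sum>w\<in>U. a w * cos (real j * t w)) = d"
    by (rule full_row_rank_cos_solution[OF assms(3) _ assms(5)])
  define x where "x = vec n (\<lambda>j. \<Sum>w\<in>U. a w * cos (real j * t w))"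
  have rank: "mat_rank (sym_toeplitz x) \<le> 2 * m"
    using mat_rank_sym_toeplitz_cos_le[OF \<open>finite U\<close>, of n a t] unfolding x_def \<open>card U = m\<close> .
  have x: "x \<in> carrier_vec n" "B *\<^sub>v x = d"
    using sol by (simp_all add: x_def)
  then have "x \<in> feasible B d"
    using assms(3) by (simp add: feasible_def)
  \<comment> \<open>The infimum is bounded by the rank at any single feasible point.\<close>
  then have "optimal_value B d \<le> enat (2 * m)"
    unfolding optimal_value_def using rank by (intro INF_lower2[of x]) simp_all
  with x rank show ?thesis
    by blast
qed

end
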